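(* For $p/q\in\mathbb{Q}^{+}$ (with $p,q$ positive integers), $m\in\mathbb{N}$, $\lambda\in\mathbb{R}$, and constants $a,b,c\in\mathbb{R}$, the following inverse Laplace transform holds true: $$\mathcal{L}^{-1}\left[\frac{s^{\lambda}}{a\,s^{m}+b\,s^{p/q}+c};t\right]=t^{1/q-\lambda-1}\sum_{k=1}^{N}\frac{\mathrm{E}_{1/q,\,1/q-\lambda}\left(r_k\,t^{1/q}\right)}{P'(r_k)},$$ where $r_k$ $(k=1,\ldots,N)$ are the $N=\max(mq,p)$ different roots of the polynomial $$P(r)=a\,r^{mq}+b\,r^{p}+c.$$
   Context: For a function $g(t)$, $t>0$, $\mathcal{L}[g(t);s]=\int_0^\infty e^{-st}g(t)\,dt$ denotes its Laplace transform; if $G(s)=\mathcal{L}[g(t);s]$, the inverse Laplace transform is denoted $\mathcal{L}^{-1}[G(s);t]=g(t)$. The two-parameter Mittag-Leffler function is $$\mathrm{E}_{\alpha,\beta}(z)=\sum_{k=0}^{\infty}\frac{z^{k}}{\Gamma(\alpha k+\beta)},\qquad \mathrm{Re}\,\alpha>0,\ \beta\in\mathbb{C},$$ where $\Gamma$ is the gamma function and $1/\Gamma$ is taken to be $0$ at the poles of $\Gamma$. $P'$ is the derivative of $P$. It is assumed that $P$ has $N$ different (in general complex) roots.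
   Formalization: The formal theorem assumes λ < N/q instead of arbitrary real λ; for λ ≥ N/q the function of s does not tend to 0 as s → +∞, so it is not a Laplace transform (e.g. m=p=q=1, a=1, b=0, c=−1, λ=1: s/(s−1)). *)

theory Defs
  imports "HOL-Analysis.Analysis" "HOL-Computational_Algebra.Polynomial"
begin

definition laplace :: "(real \<Rightarrow> complex) \<Rightarrow> complex \<Rightarrow> complex" where
  "laplace g s = (LINT t:{0<..}|lborel. exp (- (s * of_real t)) * g t)"

definition laplace_exists :: "(real \<Rightarrow> complex) \<Rightarrow> complex \<Rightarrow> bool" where
  "laplace_exists g s \<longleftrightarrow>
     set_integrable lborel {0<..} (\<lambda>t. exp (- (s * of_real t)) * g t)"

(* Inverse transforms are determined only up to null sets, so "g is an inverse transform of G"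
   is a relation. The identity between G and the transform of g is required on some right
   half-plane; only the values g t for t > 0 matter. *)
definition is_inverse_laplace :: "(complex \<Rightarrow> complex) \<Rightarrow> (real \<Rightarrow> complex) \<Rightarrow> bool" where
  "is_inverse_laplace G g \<longleftrightarrow>
     (\<exists>\<sigma>. \<forall>s. Re s > \<sigma> \<longrightarrow> laplace_exists g s \<and> laplace g s = G s)"

(* rGamma is the entire function 1/Gamma, equal to 0 at the poles of Gamma. The series
   converges for Re \<alpha> > 0; other values of \<alpha> are not meaningful. *)
definition mittag_leffler :: "complex \<Rightarrow> complex \<Rightarrow> complex \<Rightarrow> complex" where
  "mittag_leffler \<alpha> \<beta> z = (\<Sum>k. z ^ k * rGamma (\<alpha> * of_nat k + \<beta>))"

end

theory Submission
  imports Defs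
begin

text \<open>
  With \<open>\<alpha> = 1 / q\<close> the denominator is the polynomial \<open>P\<close> evaluated at \<open>s powr \<alpha>\<close>. All roots \<open>w\<close> of
  \<open>P\<close> are simple, so \<open>1 / P\<close> has the partial fraction decomposition with residues \<open>1 / P'(w)\<close>
  (\<open>partial_fractions_simple_roots\<close>), and expanding each fraction in a geometric series for large
  \<open>Re s\<close> gives
  \<open>s powr lam / P (s powr \<alpha>) = (\<Sum>k. c k * s powr (- x k))\<close>
  with \<open>c k = (\<Sum>w. w ^ k / P'(w))\<close> and \<open>x k = \<alpha> (k + 1) - lam\<close>. The function
  \<open>t powr (x k - 1) / Gamma (x k)\<close> has the transform \<open>s powr (- x k)\<close> when \<open>x k > 0\<close>
  (\<open>laplace_powr\<close>), and summing these functions with the coefficients \<open>c k\<close> yields precisely the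
  combination of Mittag-Leffler functions in the theorem.

  Two points need an argument. The exponents \<open>x k\<close> may be nonpositive for small \<open>k\<close> when \<open>lam\<close> is
  large; but \<open>c k = 0\<close> whenever \<open>k + 1 < N\<close> (\<open>sum_root_powers_over_pderiv\<close>), so that the first
  exponent that occurs is \<open>x (N - 1) = N / q - lam > 0\<close>. The termwise transform needs absolute
  convergence (\<open>laplace_sums_powr\<close>): pointwise it is that of the Mittag-Leffler series
  (\<open>summable_mittag_leffler\<close>), while the integrals of the norms are \<open>\<bar>c k\<bar> * Re s powr (- x k)\<close> and
  hence bounded by a sum of geometric series.
\<close>

section \<open>The Laplace transform of a power\<close>

lemma real_laplace_powr:
  fixes x u :: real
  assumes x: "x > 0" and u: "u > 0"
  shows "has_bochner_integral lborel
           (\<lambda>t. indicator {0<..} t * (t powr (x - 1) * exp (- (u * t)))) (Gamma x * u powr (- x))"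
proof -
  have unscaled: "has_bochner_integral lborel
          (\<lambda>t. indicator {0<..} t * (t powr (x - 1) * exp (- t))) (Gamma x)" (is "has_bochner_integral _ ?f _")
  proof (rule has_bochner_integral_nn_integral)
    have "(\<integral>\<^sup>+ t. ennreal (?f t) \<partial>lborel)
        = (\<integral>\<^sup>+ t. ennreal (indicator {0..} t * t powr (x - 1) / exp t) \<partial>lborel)"
      by (intro nn_integral_cong_AE AE_I[where N = "{0}"])
         (auto simp: indicator_def exp_minus field_simps)
    then show "(\<integral>\<^sup>+ t. ennreal (?f t) \<partial>lborel) = ennreal (Gamma x)"
      using Gamma_conv_nn_integral_real[OF x] by simp
  qed (use x in \<open>auto simp: less_imp_le\<close>)
  have "has_bochner_integral lborel (\<lambda>t. ?f (0 + u * t)) (Gamma x /\<^sub>R \<bar>u\<bar>)"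
    using unscaled u by (subst lborel_has_bochner_integral_real_affine_iff[symmetric]) auto
  then have "has_bochner_integral lborel (\<lambda>t. u powr (1 - x) * ?f (0 + u * t))
      (u powr (1 - x) * (Gamma x /\<^sub>R \<bar>u\<bar>))"
    by (rule has_bochner_integral_mult_right)
  also have "(\<lambda>t. u powr (1 - x) * ?f (0 + u * t))
      = (\<lambda>t. indicator {0<..} t * (t powr (x - 1) * exp (- (u * t))))"
    using u by (auto simp: indicator_def fun_eq_iff powr_mult powr_diff zero_less_mult_iff)
  also have "u powr (1 - x) * (Gamma x /\<^sub>R \<bar>u\<bar>) = Gamma x * u powr (- x)"
    using u by (simp add: powr_diff powr_minus field_simps)
  finally show ?thesis .
qed

text \<open>
  The discs centred at \<open>u > 0\<close> with radius \<open>u\<close> exhaust the right half-plane: the condition says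
  \<open>\<bar>s\<bar>\<^sup>2 < 2 u Re s\<close>, which holds for every large \<open>u\<close>.
\<close>
lemma half_plane_disc:
  fixes s :: complex
  assumes "Re s > 0"
  obtains u :: real where "u > 0" "cmod (s - of_real u) < u"
proof
  define u where "u = (cmod s)\<^sup>2 / Re s"
  have "s \<noteq> 0" using assms by auto
  then show "u > 0" unfolding u_def using assms by simp
  have "u * Re s = (cmod s)\<^sup>2" using assms by (simp add: u_def)
  then have "(cmod (s - of_real u))\<^sup>2 = u\<^sup>2 - (cmod s)\<^sup>2"
    by (simp add: cmod_power2) (simp add: power2_eq_square algebra_simps)
  also have "\<dots> < u\<^sup>2" using \<open>s \<noteq> 0\<close> by simp
  finally show "cmod (s - of_real u) < u"
    using \<open>u > 0\<close> by (simp add: power_less_imp_less_base)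
qed

lemma gbinomial_uminus_mult_power:
  fixes a z :: "'a::field_char_0"
  shows "(- a gchoose n) * (- z) ^ n = pochhammer a n / fact n * z ^ n"
proof -
  have "(- 1) ^ n * (- z) ^ n = z ^ n" by (simp flip: power_mult_distrib)
  then show ?thesis by (simp add: gbinomial_pochhammer)
qed

lemma pochhammer_binomial_sums_complex:
  fixes z :: complex
  assumes "norm z < 1"
  shows "(\<lambda>n. pochhammer a n / fact n * z ^ n) sums (1 - z) powr (- a)"
  using gen_binomial_complex[of "- z" "- a"] assms by (simp add: gbinomial_uminus_mult_power)

lemma summable_pochhammer_binomial_real:
  fixes z :: real
  assumes "\<bar>z\<bar> < 1"
  shows "summable (\<lambda>n. pochhammer a n / fact n * z ^ n)"
  using gen_binomial_real[of "- z" "- a"] assms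
  by (simp add: gbinomial_uminus_mult_power sums_iff)

text \<open>
  The substitution that settles the case of real \<open>s\<close> is not available for complex \<open>s\<close>, and this is
  where analytic continuation is usually invoked. A power series does the same job here. With \<open>u\<close> as
  in \<open>half_plane_disc\<close>, expand \<open>exp (- s t) = exp (- u t) exp ((u - s) t)\<close> in powers of \<open>u - s\<close> and
  integrate termwise. The real case evaluates each term, and the resulting series is the binomial
  series of \<open>(1 - (u - s) / u) powr (- x)\<close>. The integrals of the norms give the same series at
  \<open>\<bar>u - s\<bar> / u < 1\<close>, which justifies the interchange.
\<close>
lemma laplace_powr:
  fixes x :: real and s :: complex
  assumes x: "x > 0" and s: "Re s > 0"
  shows "has_bochner_integral lborel
           (\<lambda>t. indicator {0<..} t *\<^sub>R (exp (- (s * of_real t)) * of_real (t powr (x - 1))))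
           (of_real (Gamma x) * s powr (- of_real x))"
proof -
  from half_plane_disc[OF s] obtain u :: real
    where u: "u > 0" and su: "cmod (s - of_real u) < u" .
  define d where "d = of_real u - s"
  have d: "norm d < u" using su by (simp add: d_def norm_minus_commute)
  define h where "h n t = indicator {0<..} t * (t powr (x + real n - 1) * exp (- (u * t)))" for n t
  define f where "f n t = d ^ n / fact n * of_real (h n t)" for n t
  have h: "has_bochner_integral lborel (h n) (Gamma (x + real n) * u powr (- (x + real n)))" for n
    unfolding h_def using real_laplace_powr[of "x + real n" u] x u by simp
  have h_nonneg: "h n t \<ge> 0" for n t by (simp add: h_def)
  have x': "x \<notin> \<int>\<^sub>\<le>\<^sub>0" using x by (auto elim!: nonpos_Ints_cases)
  have val: "Gamma (x + real n) * u powr (- (x + real n))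
      = Gamma x * u powr (- x) * (pochhammer x n / u ^ n)" for n
  proof -
    have "pochhammer x n = Gamma (x + real n) / Gamma x"
      using x' by (rule pochhammer_Gamma)
    then have "Gamma (x + real n) = Gamma x * pochhammer x n"
      using Gamma_real_pos[OF x] by simp
    moreover have "u powr (- (x + real n)) = u powr (- x) / u ^ n"
      using u by (simp add: powr_diff powr_realpow)
    ultimately show ?thesis by simp
  qed
  have pw: "t powr (x + real n - 1) = t powr (x - 1) * t ^ n" if "t > 0" for t n
    using that powr_add[of t "x - 1" "real n"] by (simp add: powr_realpow algebra_simps)
  have f_sums: "(\<lambda>n. f n t) sums
      (indicator {0<..} t *\<^sub>R (exp (- (s * of_real t)) * of_real (t powr (x - 1))))" for t
  proof (cases "t > 0")
    case True
    have "f n t = (of_real (t powr (x - 1) * exp (- (u * t)))) * ((d * of_real t) ^ n /\<^sub>R fact n)" for n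
      using True by (simp add: f_def h_def pw power_mult_distrib scaleR_conv_of_real divide_inverse mult_ac)
    then have "(\<lambda>n. f n t) sums ((of_real (t powr (x - 1) * exp (- (u * t)))) * exp (d * of_real t))"
      using sums_mult[OF exp_converges[of "d * of_real t"]] by (simp only:)
    also have "(of_real (t powr (x - 1) * exp (- (u * t)))) * exp (d * of_real t)
        = exp (- (s * of_real t)) * of_real (t powr (x - 1))"
    proof -
      have "of_real (exp (- (u * t))) * exp (d * of_real t) = exp (- (s * of_real t))"
        unfolding exp_of_real[symmetric] exp_add[symmetric] by (simp add: d_def algebra_simps)
      then show ?thesis by (simp add: mult_ac)
    qed
    finally show ?thesis using True by simp
  qed (simp add: f_def h_def)
  have f_int: "has_bochner_integral lborel (f n)
      (d ^ n / fact n * of_real (Gamma (x + real n) * u powr (- (x + real n))))" for n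
    unfolding f_def
    by (intro has_bochner_integral_mult_right has_bochner_integral_of_real h)
  have norm_f: "norm (f n t) = norm d ^ n / fact n * h n t" for n t
    using h_nonneg[of n t] by (simp add: f_def norm_mult norm_divide norm_power)
  have norm_int: "(\<integral>t. norm (f n t) \<partial>lborel)
      = Gamma x * u powr (- x) * (pochhammer x n / fact n * (norm d / u) ^ n)" for n
  proof -
    have "(\<integral>t. norm (f n t) \<partial>lborel) = norm d ^ n / fact n * (\<integral>t. h n t \<partial>lborel)"
      unfolding norm_f by simp
    also have "(\<integral>t. h n t \<partial>lborel) = Gamma (x + real n) * u powr (- (x + real n))"
      using h by (rule has_bochner_integral_integral_eq)
    finally show ?thesis unfolding val by (simp add: power_divide)
  qed
  have "integrable lborel (f n)" for n using f_int by (auto simp: has_bochner_integral_iff)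
  moreover have "AE t in lborel. summable (\<lambda>n. norm (f n t))"
  proof (intro AE_I2)
    fix t :: real
    show "summable (\<lambda>n. norm (f n t))"
    proof (cases "t > 0")
      case True
      have "norm (f n t) = (t powr (x - 1) * exp (- (u * t))) * ((norm d * t) ^ n /\<^sub>R fact n)" for n
        using True by (simp add: norm_f h_def pw power_mult_distrib divide_inverse mult_ac)
      then show ?thesis
        using summable_mult[OF summable_exp_generic[of "norm d * t"]] by (simp only:)
    qed (simp add: f_def h_def)
  qed
  moreover have "summable (\<lambda>n. \<integral>t. norm (f n t) \<partial>lborel)"
    unfolding norm_int
    by (intro summable_mult summable_pochhammer_binomial_real) (use d u in auto)
  ultimately have int: "integrable lborel (\<lambda>t. \<Sum>n. f n t)"
    and sums: "(\<lambda>n. integral\<^sup>L lborel (f n)) sums (\<integral>t. (\<Sum>n. f n t) \<partial>lborel)"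
    by (rule integrable_suminf, rule sums_integral)
  have "integral\<^sup>L lborel (f n) = of_real (Gamma x * u powr (- x))
      * (pochhammer (of_real x) n / fact n * (d / of_real u) ^ n)" for n
    unfolding has_bochner_integral_integral_eq[OF f_int] val
    by (simp add: power_divide pochhammer_of_real)
  moreover have "(\<lambda>n. of_real (Gamma x * u powr (- x))
      * (pochhammer (of_real x) n / fact n * (d / of_real u) ^ n)) sums
      (of_real (Gamma x * u powr (- x)) * (1 - d / of_real u) powr (- of_real x))"
    by (intro sums_mult pochhammer_binomial_sums_complex) (use d u in \<open>auto simp: norm_divide\<close>)
  ultimately have "(\<integral>t. (\<Sum>n. f n t) \<partial>lborel)
      = of_real (Gamma x * u powr (- x)) * (1 - d / of_real u) powr (- of_real x)"
    using sums_unique2[OF sums] by simp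
  also have "1 - d / of_real u = s / of_real u"
    using u by (simp add: d_def field_simps)
  also have "(s / of_real u) powr (- of_real x) = of_real (u powr x) * s powr (- of_real x)"
  proof -
    have "s \<noteq> 0" using s by auto
    then have "Ln (s / of_real u) = Ln s - of_real (ln u)"
      using u by (simp add: Ln_divide_of_real)
    then have "- of_real x * Ln (s / of_real u) = of_real (x * ln u) + (- of_real x) * Ln s"
      by (simp only:) (simp add: algebra_simps)
    then have "(s / of_real u) powr (- of_real x)
        = exp (of_real (x * ln u) + (- of_real x) * Ln s)"
      using u \<open>s \<noteq> 0\<close> by (simp add: powr_def)
    also have "\<dots> = of_real (u powr x) * s powr (- of_real x)"
      unfolding exp_add exp_of_real using u \<open>s \<noteq> 0\<close> by (simp add: powr_def)
    finally show ?thesis .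
  qed
  finally have "(\<integral>t. (\<Sum>n. f n t) \<partial>lborel) = of_real (Gamma x) * s powr (- of_real x)"
    using u by (simp add: powr_minus field_simps)
  then show ?thesis
    using int f_sums by (simp add: has_bochner_integral_iff sums_iff)
qed

section \<open>Convergence of the Mittag-Leffler series\<close>

text \<open>
  The integrand of \<open>Gamma x * R powr (- x) = (\<integral>t. t powr (x - 1) * exp (- R t))\<close> is at least
  \<open>exp (- 2 R)\<close> on \<open>{1..2}\<close>, because \<open>t powr (x - 1) \<ge> 1\<close> there for \<open>x \<ge> 1\<close>. Since \<open>R\<close> is arbitrary, \<open>rGamma\<close> decays faster than every exponential,
  which is all that the convergence of the Mittag-Leffler series requires.
\<close>
lemma rGamma_le_exp_powr:
  fixes x R :: real
  assumes x: "x \<ge> 1" and R: "R > 0"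
  shows "rGamma x \<le> exp (2 * R) * R powr (- x)"
proof -
  let ?f = "\<lambda>t. indicator {0<..} t * (t powr (x - 1) * exp (- (R * t)))"
  let ?g = "\<lambda>t. indicator {1..2::real} t * exp (- (2 * R))"
  have f: "has_bochner_integral lborel ?f (Gamma x * R powr (- x))"
    using real_laplace_powr[of x R] x R by simp
  have g: "has_bochner_integral lborel ?g (1 * exp (- (2 * R)))"
    using has_bochner_integral_real_indicator[of "{1..2::real}" lborel]
    by (intro has_bochner_integral_mult_left) simp
  have "integral\<^sup>L lborel ?g \<le> integral\<^sup>L lborel ?f"
  proof (rule integral_mono)
    show "?g t \<le> ?f t" for t
    proof (cases "t \<in> {1..2}")
      case True
      have "1 * exp (- (2 * R)) \<le> t powr (x - 1) * exp (- (R * t))"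
        using True x R by (intro mult_mono ge_one_powr_ge_zero) auto
      then show ?thesis using True by simp
    qed simp
  qed (use f g in \<open>auto simp: has_bochner_integral_iff\<close>)
  then have "exp (- (2 * R)) \<le> Gamma x * R powr (- x)"
    using f g by (simp add: has_bochner_integral_iff)
  then show ?thesis
    using x R Gamma_real_pos[of x]
    by (simp add: rGamma_inverse_Gamma exp_minus field_simps)
qed

lemma summable_mittag_leffler:
  fixes \<alpha> \<beta> :: real and z :: complex
  assumes \<alpha>: "\<alpha> > 0"
  shows "summable (\<lambda>k. norm (z ^ k * of_real (rGamma (\<alpha> * real k + \<beta>))))"
proof -
  (* R is chosen so that R powr alpha = B exceeds norm z; the bound then has a geometric majorant *)
  define B where "B = 2 * norm z + 1"
  define R where "R = B powr (1 / \<alpha>)"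
  have B: "B > 0" by (simp add: B_def add_nonneg_pos)
  then have R: "R > 0" by (simp add: R_def)
  have RB: "R powr (- (\<alpha> * real k + \<beta>)) = R powr (- \<beta>) / B ^ k" for k
  proof -
    have "R powr (\<alpha> * real k) = B ^ k"
      using \<alpha> B by (simp add: R_def powr_powr powr_realpow)
    then show ?thesis by (simp add: powr_diff powr_minus field_simps powr_add)
  qed
  have "eventually (\<lambda>k. \<alpha> * real k + \<beta> \<ge> 1) sequentially"
    using \<alpha> by real_asymp
  then have "eventually (\<lambda>k. norm (norm (z ^ k * of_real (rGamma (\<alpha> * real k + \<beta>))))
      \<le> exp (2 * R) * R powr (- \<beta>) * (norm z / B) ^ k) sequentially"
  proof eventually_elim
    case (elim k)
    have "rGamma (\<alpha> * real k + \<beta>) \<le> exp (2 * R) * (R powr (- \<beta>) / B ^ k)"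
      using rGamma_le_exp_powr[OF elim R] by (simp only: RB)
    moreover have "rGamma (\<alpha> * real k + \<beta>) \<ge> 0"
      using elim by (simp add: rGamma_inverse_Gamma less_imp_le)
    ultimately have "norm z ^ k * \<bar>rGamma (\<alpha> * real k + \<beta>)\<bar>
        \<le> norm z ^ k * (exp (2 * R) * (R powr (- \<beta>) / B ^ k))"
      by (intro mult_left_mono) auto
    then show ?case by (simp add: norm_mult norm_power power_divide mult_ac)
  qed
  moreover have "summable (\<lambda>k. exp (2 * R) * R powr (- \<beta>) * (norm z / B) ^ k)"
    using B by (intro summable_mult summable_geometric) (simp add: B_def)
  ultimately show ?thesis by (rule summable_comparison_test_ev)
qed

section \<open>Laplace transforms of series of powers\<close>

text \<open>
  A nonpositive \<open>x k\<close> is admitted only with \<open>c k = 0\<close>. Otherwise the term is not integrable at the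
  origin or, if \<open>x k\<close> is a pole of \<open>Gamma\<close>, it vanishes while the proposed transform
  \<open>c k * s powr (- x k)\<close> does not. The Mittag-Leffler sum has this property by
  \<open>sum_root_powers_over_pderiv\<close>.
\<close>
lemma laplace_sums_powr:
  fixes c :: "nat \<Rightarrow> complex" and x :: "nat \<Rightarrow> real" and g :: "real \<Rightarrow> complex" and s :: complex
  assumes s: "Re s > 0"
    and x: "\<And>k. c k \<noteq> 0 \<Longrightarrow> x k > 0"
    and g: "\<And>t. t > 0 \<Longrightarrow> (\<lambda>k. c k * of_real (rGamma (x k) * t powr (x k - 1))) sums g t"
    and g_abs: "\<And>t. t > 0 \<Longrightarrow> summable (\<lambda>k. norm (c k * of_real (rGamma (x k) * t powr (x k - 1))))"
    and c: "summable (\<lambda>k. norm (c k) * Re s powr (- x k))"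
  shows "laplace_exists g s" and "(\<lambda>k. c k * s powr (- of_real (x k))) sums laplace g s"
proof -
  define e where "e k t = indicator {0<..} t *\<^sub>R (exp (- (s * of_real t)) * of_real (t powr (x k - 1)))"
    for k t
  define f where "f k t = c k * of_real (rGamma (x k)) * e k t" for k t
  have f_int: "has_bochner_integral lborel (f k) (c k * s powr (- of_real (x k)))" for k
  proof (cases "c k = 0")
    case False
    then have pos: "x k > 0" by (rule x)
    have "has_bochner_integral lborel (f k)
        (c k * of_real (rGamma (x k)) * (of_real (Gamma (x k)) * s powr (- of_real (x k))))"
      unfolding f_def e_def by (intro has_bochner_integral_mult_right laplace_powr pos s)
    moreover have "rGamma (x k) * Gamma (x k) = 1"
      using Gamma_real_pos[OF pos] by (simp add: rGamma_inverse_Gamma)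
    then have "complex_of_real (rGamma (x k)) * of_real (Gamma (x k)) = 1"
      by (simp flip: of_real_mult)
    then have "c k * of_real (rGamma (x k)) * (of_real (Gamma (x k)) * s powr (- of_real (x k)))
        = c k * s powr (- of_real (x k))"
      by (simp add: mult.assoc)
    ultimately show ?thesis by simp
  qed (simp add: f_def[abs_def] has_bochner_integral_zero)
  have norm_int: "(\<integral>t. norm (f k t) \<partial>lborel) = norm (c k) * Re s powr (- x k)" for k
  proof (cases "c k = 0")
    case False
    then have pos: "x k > 0" by (rule x)
    have "rGamma (x k) \<ge> 0" using pos by (simp add: rGamma_inverse_Gamma less_imp_le)
    then have "norm (f k t) = norm (c k) * rGamma (x k)
        * (indicator {0<..} t * (t powr (x k - 1) * exp (- (Re s * t))))" for t
      by (simp add: f_def e_def norm_mult mult_ac)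
    then have "(\<integral>t. norm (f k t) \<partial>lborel)
        = norm (c k) * rGamma (x k) * (Gamma (x k) * Re s powr (- x k))"
      using has_bochner_integral_integral_eq[OF real_laplace_powr[OF pos s]] by simp
    then show ?thesis using Gamma_real_pos[OF pos] by (simp add: rGamma_inverse_Gamma)
  qed (simp add: f_def)
  have f_eq: "f k t = exp (- (s * of_real t)) * (c k * of_real (rGamma (x k) * t powr (x k - 1)))"
    if "t > 0" for k t
    using that by (simp add: f_def e_def mult_ac)
  have f_sums: "(\<lambda>k. f k t) sums (indicator {0<..} t *\<^sub>R (exp (- (s * of_real t)) * g t))" for t
    using sums_mult[OF g[of t], of "exp (- (s * of_real t))"]
    by (cases "t > 0") (simp add: f_eq, simp add: f_def e_def)
  have f_abs: "summable (\<lambda>k. norm (f k t))" for t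
    using summable_mult[OF g_abs[of t], of "norm (exp (- (s * of_real t)))"]
    by (cases "t > 0") (simp add: f_eq norm_mult, simp add: f_def e_def)
  have "integrable lborel (f k)" for k using f_int by (auto simp: has_bochner_integral_iff)
  moreover have "AE t in lborel. summable (\<lambda>k. norm (f k t))" using f_abs by simp
  moreover have "summable (\<lambda>k. \<integral>t. norm (f k t) \<partial>lborel)" unfolding norm_int by (rule c)
  ultimately have int: "integrable lborel (\<lambda>t. \<Sum>k. f k t)"
    and sums: "(\<lambda>k. integral\<^sup>L lborel (f k)) sums (\<integral>t. (\<Sum>k. f k t) \<partial>lborel)"
    by (rule integrable_suminf, rule sums_integral)
  have suminf: "(\<Sum>k. f k t) = indicator {0<..} t *\<^sub>R (exp (- (s * of_real t)) * g t)" for t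
    using f_sums by (simp add: sums_iff)
  show "laplace_exists g s"
    using int unfolding suminf by (simp add: laplace_exists_def set_integrable_def)
  show "(\<lambda>k. c k * s powr (- of_real (x k))) sums laplace g s"
    using sums unfolding suminf has_bochner_integral_integral_eq[OF f_int]
    by (simp add: laplace_def set_lebesgue_integral_def)
qed

section \<open>Lagrange interpolation at simple roots\<close>

lemma poly_eq_synthetic_div_root:
  fixes P :: "'a::comm_ring_1 poly"
  assumes "poly P w = 0"
  shows "P = [:- w, 1:] * synthetic_div P w"
  using synthetic_div_correct'[of w P] assms by simp

lemma poly_synthetic_div_root:
  fixes P :: "'a::idom poly"
  assumes "poly P w = 0"
  shows "poly (synthetic_div P w) w = poly (pderiv P) w"
proof -
  have "pderiv P = pderiv ([:- w, 1:] * synthetic_div P w)"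
    using poly_eq_synthetic_div_root[OF assms] by simp
  then show ?thesis by (simp add: pderiv_mult pderiv_pCons del: mult_pCons_left)
qed

text \<open>
  At a root that also annihilates the derivative, the quotient \<open>synthetic_div P w\<close> would have all the
  \<open>degree P\<close> roots of \<open>P\<close>, although its degree is smaller.
\<close>
lemma poly_pderiv_root_nonzero:
  fixes P :: "'a::idom poly"
  assumes card: "card {z. poly P z = 0} = degree P" and deg: "degree P > 0"
    and w: "poly P w = 0"
  shows "poly (pderiv P) w \<noteq> 0"
proof
  let ?L = "synthetic_div P w"
  assume "poly (pderiv P) w = 0"
  then have Lw: "poly ?L w = 0" using w by (simp add: poly_synthetic_div_root)
  have L0: "?L \<noteq> 0" using deg by (simp add: synthetic_div_eq_0_iff)
  have "poly P z = (z - w) * poly ?L z" for z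
    by (subst poly_eq_synthetic_div_root[OF w]) (simp add: algebra_simps)
  then have "{z. poly P z = 0} \<subseteq> {z. poly ?L z = 0}" using Lw by auto
  then have "card {z. poly P z = 0} \<le> card {z. poly ?L z = 0}"
    using L0 by (intro card_mono poly_roots_finite)
  also have "\<dots> \<le> degree ?L" using L0 by (rule card_poly_roots_bound)
  finally show False using card deg by (simp add: degree_synthetic_div)
qed

text \<open>
  The polynomials \<open>synthetic_div P w / poly (pderiv P) w\<close> are the Lagrange basis for the roots of
  \<open>P\<close>: each is \<open>1\<close> at its own root and \<open>0\<close> at the others. Powers of degree less than the number of
  roots are therefore reproduced by interpolation. Comparing the coefficients of
  degree \<open>degree P - 1\<close> gives
  \<open>sum_root_powers_over_pderiv\<close>, and dividing the case \<open>k = 0\<close> by \<open>P\<close> gives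
  \<open>partial_fractions_simple_roots\<close>.
\<close>
lemma lagrange_interpolation_power:
  fixes P :: "'a::field poly"
  assumes card: "card {z. poly P z = 0} = degree P" and k: "k < degree P"
  shows "(\<Sum>w | poly P w = 0. smult (w ^ k / poly (pderiv P) w) (synthetic_div P w)) = monom 1 k"
    (is "?S = _")
proof (rule poly_eqI_degree)
  let ?Z = "{z. poly P z = 0}"
  have deg: "degree P > 0" using k by simp
  then have fin: "finite ?Z" by (intro poly_roots_finite) auto
  have "degree ?S \<le> degree P - 1"
    by (intro degree_sum_le fin order_trans[OF degree_smult_le]) (simp add: degree_synthetic_div)
  then show "card ?Z > degree ?S" using card deg by linarith
  show "card ?Z > degree (monom (1::'a) k)"
    using card k by (simp add: degree_monom_eq)
  fix v assume v: "v \<in> ?Z"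
  have "poly (synthetic_div P w) v = 0" if "w \<in> ?Z" "w \<noteq> v" for w
  proof -
    have "poly P v = (v - w) * poly (synthetic_div P w) v"
      using that by (subst poly_eq_synthetic_div_root[of P w]) (auto simp: algebra_simps)
    then show ?thesis using v that by simp
  qed
  then have "poly ?S v = (\<Sum>w\<in>?Z. if w = v
      then w ^ k / poly (pderiv P) w * poly (synthetic_div P w) v else 0)"
    unfolding poly_sum by (intro sum.cong) auto
  also have "\<dots> = v ^ k / poly (pderiv P) v * poly (synthetic_div P v) v"
    using fin v by simp
  also have "\<dots> = v ^ k"
    using v poly_pderiv_root_nonzero[OF card deg] by (simp add: poly_synthetic_div_root)
  finally show "poly ?S v = poly (monom 1 k) v" by (simp add: poly_monom)
qed

lemma sum_root_powers_over_pderiv: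
  fixes P :: "'a::field poly"
  assumes card: "card {z. poly P z = 0} = degree P" and k: "Suc k < degree P"
  shows "(\<Sum>w | poly P w = 0. w ^ k / poly (pderiv P) w) = 0"
proof -
  have top: "coeff (synthetic_div P w) (degree P - 1) = lead_coeff P" if "poly P w = 0" for w
  proof -
    have "lead_coeff P = lead_coeff [:- w, 1:] * lead_coeff (synthetic_div P w)"
      using poly_eq_synthetic_div_root[OF that] lead_coeff_mult by metis
    then show ?thesis by (simp add: degree_synthetic_div)
  qed
  have "0 = coeff (monom (1::'a) k) (degree P - 1)" using k by simp
  also have "monom (1::'a) k
      = (\<Sum>w | poly P w = 0. smult (w ^ k / poly (pderiv P) w) (synthetic_div P w))"
    using lagrange_interpolation_power[OF card, of k] k by simp
  also have "coeff \<dots> (degree P - 1)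
      = (\<Sum>w | poly P w = 0. w ^ k / poly (pderiv P) w * lead_coeff P)"
    unfolding coeff_sum by (intro sum.cong) (use top in auto)
  also have "\<dots> = (\<Sum>w | poly P w = 0. w ^ k / poly (pderiv P) w) * lead_coeff P"
    by (simp add: sum_distrib_right)
  finally show ?thesis using k by auto
qed

lemma partial_fractions_simple_roots:
  fixes P :: "'a::field poly"
  assumes card: "card {z. poly P z = 0} = degree P" and deg: "degree P > 0"
    and z: "poly P z \<noteq> 0"
  shows "(\<Sum>w | poly P w = 0. 1 / (poly (pderiv P) w * (z - w))) = 1 / poly P z"
proof -
  have "1 / (poly (pderiv P) w * (z - w))
      = poly (smult (w ^ 0 / poly (pderiv P) w) (synthetic_div P w)) z / poly P z"
    if w: "poly P w = 0" for w
  proof -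
    have "poly P z = (z - w) * poly (synthetic_div P w) z"
      by (subst poly_eq_synthetic_div_root[OF w]) (simp add: algebra_simps)
    then show ?thesis using z by simp
  qed
  then have "(\<Sum>w | poly P w = 0. 1 / (poly (pderiv P) w * (z - w)))
      = (\<Sum>w | poly P w = 0. poly (smult (w ^ 0 / poly (pderiv P) w) (synthetic_div P w)) z / poly P z)"
    by (intro sum.cong) auto
  also have "\<dots> = poly (\<Sum>w | poly P w = 0.
      smult (w ^ 0 / poly (pderiv P) w) (synthetic_div P w)) z / poly P z"
    by (simp add: poly_sum sum_divide_distrib)
  also have "\<dots> = 1 / poly P z"
    using lagrange_interpolation_power[OF card deg] by (simp add: poly_monom)
  finally show ?thesis .
qed

section \<open>Inverting a power divided by a polynomial in a fractional power\<close>

lemma complex_powr_power: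
  fixes s a :: complex
  assumes "s \<noteq> 0"
  shows "(s powr a) ^ n = s powr (of_nat n * a)"
  using assms by (simp add: powr_def mult.assoc flip: exp_of_nat_mult)

lemma summable_norm_sum:
  fixes b :: "'i \<Rightarrow> nat \<Rightarrow> 'a::real_normed_vector"
  assumes "\<And>w. w \<in> Z \<Longrightarrow> summable (\<lambda>k. norm (b w k))"
  shows "summable (\<lambda>k. norm (\<Sum>w\<in>Z. b w k))"
proof (rule summable_comparison_test')
  show "summable (\<lambda>k. \<Sum>w\<in>Z. norm (b w k))" using assms by (rule summable_sum)
qed (simp add: norm_sum)

text \<open>
  For a single root \<open>w\<close> the formula is the classical pair \<open>t powr (\<beta> - 1) * E(w t powr \<alpha>)\<close> and
  \<open>s powr (\<alpha> - \<beta>) / (s powr \<alpha> - w)\<close> with \<open>\<beta> = \<alpha> - lam\<close>. That pair fails for \<open>\<beta> \<le> 0\<close>: its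
  first powers of \<open>t\<close> are then not integrable or are lost at a pole of \<open>Gamma\<close>. Hence the transform
  is applied to the whole sum over the roots, ordered by powers of \<open>t\<close>. The powers below \<open>t powr (\<alpha> * degree P - lam - 1)\<close> then
  cancel, and this exponent exceeds \<open>-1\<close> by the assumption on \<open>lam\<close>.
\<close>
lemma inverse_laplace_powr_over_poly:
  fixes P :: "complex poly" and \<alpha> lam :: real
  assumes card: "card {z. poly P z = 0} = degree P" and deg: "degree P > 0"
    and \<alpha>: "\<alpha> > 0" and lam: "lam < \<alpha> * real (degree P)"
  shows "is_inverse_laplace
    (\<lambda>s. s powr of_real lam / poly P (s powr of_real \<alpha>))
    (\<lambda>t. of_real (t powr (\<alpha> - lam - 1)) *
       (\<Sum>w | poly P w = 0. mittag_leffler (of_real \<alpha>) (of_real (\<alpha> - lam)) (w * of_real (t powr \<alpha>))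
          / poly (pderiv P) w))"
    (is "is_inverse_laplace ?G ?g")
proof -
  define Z where "Z = {w. poly P w = 0}"
  define D where "D w = poly (pderiv P) w" for w
  define \<beta> where "\<beta> = \<alpha> - lam"
  define x where "x k = \<alpha> * real k + \<beta>" for k
  define c where "c k = (\<Sum>w\<in>Z. w ^ k / D w)" for k
  (* Re s > \<sigma> forces norm w < (Re s) powr \<alpha> \<le> norm (s powr \<alpha>) for every root w, so that the
     geometric series in w / s powr \<alpha> converge absolutely and s powr \<alpha> is not a root itself *)
  define \<sigma> where "\<sigma> = (\<Sum>w\<in>Z. norm w powr (1 / \<alpha>))"
  have fin: "finite Z" unfolding Z_def using deg by (intro poly_roots_finite) auto
  have x_pos: "x k > 0" if "c k \<noteq> 0" for k
  proof -
    have "degree P \<le> Suc k"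
      using sum_root_powers_over_pderiv[OF card, of k] that
      by (force simp: c_def Z_def D_def not_less)
    then have "\<alpha> * real (degree P) \<le> \<alpha> * (real k + 1)"
      using \<alpha> by (intro mult_left_mono) auto
    then show ?thesis using lam by (simp add: x_def \<beta>_def algebra_simps)
  qed
  define b where "b t w k = of_real (t powr (\<beta> - 1)) / D w
      * ((w * of_real (t powr \<alpha>)) ^ k * of_real (rGamma (\<alpha> * real k + \<beta>)))" for t w k
  have b_abs: "summable (\<lambda>k. norm (b t w k))" for t w
    unfolding b_def norm_mult[of "_ / _"] by (intro summable_mult summable_mittag_leffler \<alpha>)
  have c_b: "c k * of_real (rGamma (x k) * t powr (x k - 1)) = (\<Sum>w\<in>Z. b t w k)" if "t > 0" for t k
  proof -
    have "t powr (x k - 1) = t powr (\<beta> - 1) * (t powr \<alpha>) ^ k"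
      using that powr_add[of t "\<beta> - 1" "\<alpha> * real k"]
      by (simp add: x_def powr_powr algebra_simps flip: powr_realpow)
    then show ?thesis
      by (simp add: c_def b_def x_def sum_distrib_left power_mult_distrib mult_ac)
  qed
  have b_sums: "(\<lambda>k. b t w k) sums (of_real (t powr (\<beta> - 1)) / D w
      * mittag_leffler (of_real \<alpha>) (of_real \<beta>) (w * of_real (t powr \<alpha>)))" for t w
  proof -
    have "summable (\<lambda>k. (w * of_real (t powr \<alpha>)) ^ k * complex_of_real (rGamma (\<alpha> * real k + \<beta>)))"
      by (rule summable_norm_cancel[OF summable_mittag_leffler[OF \<alpha>]])
    moreover have "rGamma (of_real \<alpha> * of_nat k + of_real \<beta> :: complex)
        = of_real (rGamma (\<alpha> * real k + \<beta>))" for k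
      by (simp flip: rGamma_complex_of_real)
    ultimately show ?thesis
      unfolding b_def mittag_leffler_def by (intro sums_mult) (simp add: summable_sums)
  qed
  have "laplace_exists ?g s \<and> laplace ?g s = ?G s" if s: "Re s > \<sigma>" for s
  proof -
    define u where "u = Re s"
    define S where "S = s powr of_real \<alpha>"
    have "\<sigma> \<ge> 0" unfolding \<sigma>_def by (intro sum_nonneg) auto
    then have u: "u > 0" using s by (simp add: u_def)
    then have s0: "s \<noteq> 0" by (auto simp: u_def)
    have root_less: "norm w < u powr \<alpha>" if w: "w \<in> Z" for w
    proof -
      have "norm w powr (1 / \<alpha>) \<le> \<sigma>" unfolding \<sigma>_def using fin w by (intro member_le_sum) auto
      then have "(norm w powr (1 / \<alpha>)) powr \<alpha> < u powr \<alpha>"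
        using s \<alpha> by (intro powr_less_mono2) (auto simp: u_def)
      then show ?thesis using \<alpha> by (simp add: powr_powr)
    qed
    have "norm S = norm s powr \<alpha>" by (simp add: S_def norm_powr_real_powr')
    then have S_ge: "norm S \<ge> u powr \<alpha>"
      using u \<alpha> complex_Re_le_cmod[of s] by (auto simp: u_def intro!: powr_mono2)
    have S0: "S \<noteq> 0" using s0 by (simp add: S_def)
    have PS: "poly P S \<noteq> 0" using root_less[of S] S_ge by (auto simp: Z_def)
    have g_sums: "(\<lambda>k. c k * of_real (rGamma (x k) * t powr (x k - 1))) sums ?g t" if "t > 0" for t
    proof -
      have "(\<lambda>k. \<Sum>w\<in>Z. b t w k) sums (\<Sum>w\<in>Z. of_real (t powr (\<beta> - 1)) / D w
          * mittag_leffler (of_real \<alpha>) (of_real \<beta>) (w * of_real (t powr \<alpha>)))"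
        by (intro sums_sum b_sums)
      then show ?thesis
        unfolding c_b[OF that] by (simp add: sum_distrib_left Z_def D_def \<beta>_def)
    qed
    have g_abs: "summable (\<lambda>k. norm (c k * of_real (rGamma (x k) * t powr (x k - 1))))" if "t > 0" for t
      unfolding c_b[OF that] by (intro summable_norm_sum b_abs)
    have c_norm: "norm (c k) * u powr (- x k) =
        norm (\<Sum>w\<in>Z. of_real (u powr (- \<beta>)) / D w * (w / of_real (u powr \<alpha>)) ^ k)" for k
    proof -
      have "u powr (\<alpha> * real k) = (u powr \<alpha>) ^ k"
        using u by (simp add: powr_powr flip: powr_realpow)
      then have "u powr (- x k) = u powr (- \<beta>) / (u powr \<alpha>) ^ k"
        by (simp add: x_def powr_diff powr_minus powr_add field_simps)
      then have "norm (c k) * u powr (- x k) = norm (c k * of_real (u powr (- \<beta>) / (u powr \<alpha>) ^ k))"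
        by (simp add: norm_mult norm_divide norm_power)
      then show ?thesis
        by (simp add: c_def sum_distrib_left sum_divide_distrib power_divide mult_ac)
    qed
    have c_abs: "summable (\<lambda>k. norm (c k) * u powr (- x k))"
      unfolding c_norm
    proof (rule summable_norm_sum)
      fix w assume "w \<in> Z"
      then have "norm w / u powr \<alpha> < 1" using root_less u by simp
      then show "summable (\<lambda>k. norm (of_real (u powr (- \<beta>)) / D w * (w / of_real (u powr \<alpha>)) ^ k))"
        by (simp add: norm_mult norm_divide norm_power summable_mult summable_geometric)
    qed
    note laplace = laplace_sums_powr[of s c x ?g, OF u[unfolded u_def] x_pos g_sums g_abs c_abs[unfolded u_def]]
    have "c k * s powr (- of_real (x k)) = (\<Sum>w\<in>Z. s powr (- of_real \<beta>) / D w * (w / S) ^ k)" for k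
    proof -
      have "S ^ k = s powr of_real (\<alpha> * real k)"
        using s0 by (simp add: S_def complex_powr_power mult_ac)
      then have "s powr (- of_real (x k)) = s powr (- of_real \<beta>) / S ^ k"
        by (simp add: x_def powr_diff powr_minus powr_add field_simps)
      then show ?thesis
        by (simp add: c_def sum_distrib_left sum_divide_distrib power_divide mult_ac)
    qed
    moreover have "(\<lambda>k. \<Sum>w\<in>Z. s powr (- of_real \<beta>) / D w * (w / S) ^ k) sums
        (\<Sum>w\<in>Z. s powr (- of_real \<beta>) / D w * (1 / (1 - w / S)))"
      using root_less S_ge S0
      by (intro sums_sum sums_mult geometric_sums) (force simp: norm_divide)
    ultimately have "laplace ?g s = (\<Sum>w\<in>Z. s powr (- of_real \<beta>) / D w * (1 / (1 - w / S)))"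
      using sums_unique2[OF laplace(2)] by simp
    also have "\<dots> = (\<Sum>w\<in>Z. s powr (- of_real \<beta>) * S * (1 / (D w * (S - w))))"
      using S0 by (intro sum.cong) (auto simp: field_simps)
    also have "\<dots> = s powr (- of_real \<beta>) * S * (1 / poly P S)"
      using partial_fractions_simple_roots[OF card deg PS]
      by (simp only: Z_def D_def sum_distrib_left[symmetric])
    also have "s powr (- of_real \<beta>) * S = s powr of_real lam"
      by (simp add: S_def \<beta>_def flip: powr_add)
    finally show ?thesis using laplace(1) by (simp add: S_def)
  qed
  then show ?thesis unfolding is_inverse_laplace_def by blast
qed

text \<open>
  As \<open>P\<close> has \<open>N\<close> roots and its degree is at most \<open>N\<close>, its degree is \<open>N\<close> and every root is simple.
  The claim is then the general inversion formula with \<open>\<alpha> = 1 / q\<close>, since the denominator is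
  \<open>P (s powr (1 / q))\<close>.
\<close>
theorem theorem5:
  fixes p q m N :: nat and lam a b c :: real
    and P :: "complex poly" and r :: "nat \<Rightarrow> complex"
  assumes "p > 0" and "q > 0"
    and P_eq: "P = monom (of_real a) (m * q) + monom (of_real b) p + [:of_real c:]"
    and N_eq: "N = max (m * q) p"
    and roots: "bij_betw r {1..N} {z. poly P z = 0}"
    and lambda: "lam < real N / real q"
  shows "is_inverse_laplace
    (\<lambda>s. s powr of_real lam /
          (of_real a * s ^ m + of_real b * s powr of_real (real p / real q) + of_real c))
    (\<lambda>t. of_real (t powr (1 / real q - lam - 1)) *
          (\<Sum>k=1..N. mittag_leffler (of_real (1 / real q)) (of_real (1 / real q - lam))
                        (r k * of_real (t powr (1 / real q)))
                      / poly (pderiv P) (r k)))"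
proof -
  have N: "N > 0" using N_eq \<open>p > 0\<close> by simp
  have card: "card {z. poly P z = 0} = N" using bij_betw_same_card[OF roots] by simp
  have "finite {z. poly P z = 0}" using bij_betw_finite[OF roots] by simp
  then have "P \<noteq> 0" using infinite_UNIV_char_0[where 'a = complex] by auto
  then have "N \<le> degree P" using card_poly_roots_bound[of P] card by simp
  moreover have "degree P \<le> N"
    unfolding P_eq N_eq
    by (intro degree_add_le order_trans[OF degree_monom_le]) auto
  ultimately have deg: "degree P = N" by simp
  have "poly P (s powr of_real (1 / real q))
      = of_real a * s ^ m + of_real b * s powr of_real (real p / real q) + of_real c" for s
  proof (cases "s = 0")
    case False
    have "(s powr of_real (1 / real q)) ^ n = s powr of_real (real n / real q)" for n
      using False by (simp add: complex_powr_power)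
    moreover have "real (m * q) / real q = real m" using \<open>q > 0\<close> by simp
    ultimately show ?thesis
      using False by (simp only: P_eq poly_add poly_monom) (simp add: powr_nat')
  qed (use \<open>p > 0\<close> \<open>q > 0\<close> in \<open>simp add: P_eq poly_monom power_0_left\<close>)
  moreover have "(\<Sum>w | poly P w = 0. f w) = (\<Sum>k=1..N. f (r k))" for f :: "complex \<Rightarrow> complex"
    using sum.reindex_bij_betw[OF roots, of f] by simp
  ultimately show ?thesis
    using inverse_laplace_powr_over_poly[of P "1 / real q" lam] card deg N \<open>q > 0\<close> lambda
    by simp
qed

end
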